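(* Let $m$ be a positive integer, let $a_0,a_1,\ldots,a_m$ be real (or complex) numbers, let $P_m(x)=\sum_{k=0}^m a_kx^{m-k}$ and $P_m^*(x)=\sum_{k=0}^m a_kx^k$, and let $\varepsilon\in\{1,-1\}$. Then the following statements are equivalent: (a) $(1-x)^mP_m^*\big(\frac{x}{x-1}\big)=\varepsilon P_m^*(x)$ (as rational functions of $x$); (b) $P_m(1-x)=\varepsilon(-1)^mP_m(x)$; (c) for $n=0,1,\ldots,m$ we have $\sum_{k=0}^n\binom{n-m-1}{k}(-1)^{n-k}a_{n-k}=\varepsilon a_n$; (d) setting $a_n=0$ for $n>m$, we have $\sum_{k=0}^n\binom{n-m-1}{k}(-1)^{n-k}a_{n-k}=\varepsilon a_n$ for all $n=0,1,2,\ldots$; (e) for $n=0,1,\ldots,m$ we have $$\sum_{k=0}^n\binom nk\frac{a_k}{\binom mk}=\varepsilon(-1)^n\frac{a_n}{\binom mn}.$$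
   Context: For real $x$ and a nonnegative integer $k$, $\binom xk=x(x-1)\cdots(x-k+1)/k!$ (with $\binom x0=1$). *)

theory Defs
  imports
    Complex_Main
    "HOL-Computational_Algebra.Polynomial_Factorial"
begin

text \<open>
  The class \<open>real_normed_field\<close> has, up to isomorphism, exactly the members \<open>real\<close> and \<open>complex\<close>
  (Gelfand--Mazur), so it is the rendering of ``real (or complex)'' used here.
  Only \<open>a 0, \<dots>, a m\<close> matter below.
\<close>

definition P_poly :: "nat \<Rightarrow> (nat \<Rightarrow> 'a::real_normed_field) \<Rightarrow> 'a poly" where
  "P_poly m a = (\<Sum>k\<le>m. monom (a k) (m - k))"

definition P_star :: "nat \<Rightarrow> (nat \<Rightarrow> 'a::real_normed_field) \<Rightarrow> 'a poly" where
  "P_star m a = (\<Sum>k\<le>m. monom (a k) k)"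

text \<open>
  Rational functions in one variable over \<open>'a\<close> are the field of fractions \<open>'a poly fract\<close>.
  \<open>rf_var\<close> is the variable \<open>x\<close>, and \<open>rf_subst p r\<close> is the rational function \<open>p(r(x))\<close>, obtained by
  evaluating \<open>p\<close> (its coefficients read as constant rational functions) at \<open>r\<close>.
\<close>

definition rf_var :: "'a::real_normed_field poly fract" where
  "rf_var = to_fract [:0, 1:]"

definition rf_subst :: "'a::real_normed_field poly \<Rightarrow> 'a poly fract \<Rightarrow> 'a poly fract" where
  "rf_subst p r = poly (map_poly (\<lambda>c. to_fract [:c:]) p) r"

lemma rf_subst_rf_var: "rf_subst p rf_var = to_fract p"
proof (induction p)
  case 0
  show ?case by (simp add: rf_subst_def)
next
  case (pCons a p)
  have "pCons a p = [:a:] + [:0, 1:] * p" by simp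
  then have "to_fract (pCons a p) = to_fract [:a:] + to_fract [:0, 1:] * to_fract p"
    by (metis to_fract_add to_fract_mult)
  with pCons show ?case
    by (simp only: rf_subst_def rf_var_def map_poly_pCons pCons_0_0 to_fract_0 poly_pCons)
qed

definition zero_ext :: "nat \<Rightarrow> (nat \<Rightarrow> 'a::real_normed_field) \<Rightarrow> nat \<Rightarrow> 'a" where
  "zero_ext m a n = (if n \<le> m then a n else 0)"

end

theory Submission
  imports Defs
begin

text \<open>
  With $S_n = \sum_{k \le n} \binom{m-k}{n-k} a_k$, each of the five conditions says that
  $S_n = \varepsilon (-1)^n a_n$ for all $n \le m$. The coefficient of $x^n$ in
  $(1-x)^m P_m^*(x/(x-1)) = \sum_k (-1)^k a_k x^k (1-x)^{m-k}$ is $(-1)^n S_n$, the coefficient of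
  $x^{m-n}$ in $P_m(1-x)$ is $(-1)^{m-n} S_n$, negating the upper index of the binomials turns the
  left-hand side of (c) into $(-1)^n S_n$, and
  $\binom nk \binom mn = \binom mk \binom{m-k}{n-k}$ turns the left-hand side of (e) into
  $S_n / \binom mn$.
\<close>

definition choose_sum :: "nat \<Rightarrow> (nat \<Rightarrow> 'a::real_normed_field) \<Rightarrow> nat \<Rightarrow> 'a" where
  "choose_sum m a n = (\<Sum>k\<le>n. of_nat ((m - k) choose (n - k)) * a k)"

section \<open>Coefficients, signs and equality of polynomials of bounded degree\<close>

text \<open>Past the degree both sides vanish, so no bound on \<open>i\<close> is imposed; the
  reflected sum below also contains such terms.\<close>

lemma coeff_one_minus_power:
  "coeff ([:1, -1:] ^ d) i = (of_nat (d choose i) * (-1) ^ i :: 'a::{idom,ring_char_0})"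
proof (cases "i \<le> d")
  case True
  then show ?thesis by (simp add: coeff_linear_poly_power)
next
  case False
  moreover have "degree ([:1, -1 :: 'a:] ^ d) = d"
    by (simp add: degree_power_eq)
  ultimately show ?thesis by (simp add: coeff_eq_0)
qed

lemma neg_one_power_diff:
  "k \<le> n \<Longrightarrow> (-1) ^ (n - k) = ((-1) ^ n * (-1) ^ k :: 'a::ring_1)"
  by (auto simp: minus_one_power_iff)

lemma coeff_P_poly: "n \<le> m \<Longrightarrow> coeff (P_poly m a) (m - n) = a n"
proof -
  assume "n \<le> m"
  then have "coeff (P_poly m a) (m - n) = (\<Sum>k\<le>m. if k = n then a k else 0)"
    unfolding P_poly_def coeff_sum by (intro sum.cong) auto
  with \<open>n \<le> m\<close> show ?thesis by simp
qed

lemma coeff_P_star: "coeff (P_star m a) n = zero_ext m a n"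
  by (simp add: P_star_def coeff_sum zero_ext_def)

lemma poly_eq_upto_iff:
  assumes "degree p \<le> m" "degree q \<le> m"
  shows "p = q \<longleftrightarrow> (\<forall>n\<le>m. coeff p n = coeff q n)"
  using assms by (metis coeff_eq_0 leI le_less_trans poly_eqI)

text \<open>The map n -> m - n permutes 0, ..., m; this indexing suits \<open>P_poly\<close>, where
  \<open>a n\<close> sits at degree \<open>m - n\<close>.\<close>

lemma poly_eq_upto_rev_iff:
  assumes "degree p \<le> m" "degree q \<le> m"
  shows "p = q \<longleftrightarrow> (\<forall>n\<le>m. coeff p (m - n) = coeff q (m - n))"
  unfolding poly_eq_upto_iff[OF assms] by (metis diff_diff_cancel diff_le_self)

section \<open>The substitution x -> x/(x-1)\<close>

text \<open>The left-hand side of (a) with denominators cleared: since k \<le> m, the prefactor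
  (1-x)^m absorbs every denominator.\<close>

definition mobius_poly :: "nat \<Rightarrow> (nat \<Rightarrow> 'a::real_normed_field) \<Rightarrow> 'a poly" where
  "mobius_poly m a = (\<Sum>k\<le>m. monom ((-1) ^ k * a k) k * [:1, -1:] ^ (m - k))"

lemma degree_mobius_poly: "degree (mobius_poly m a) \<le> m"
  unfolding mobius_poly_def
proof (rule degree_sum_le)
  fix k assume "k \<in> {..m}"
  have "degree (monom ((-1) ^ k * a k) k * [:1, -1:] ^ (m - k))
      \<le> degree (monom ((-1) ^ k * a k) k) + degree ([:1, -1 :: 'a:] ^ (m - k))"
    by (rule degree_mult_le)
  also have "\<dots> \<le> k + (m - k)"
    by (intro add_mono degree_monom_le) (simp add: degree_power_eq)
  finally show "degree (monom ((-1) ^ k * a k) k * [:1, -1:] ^ (m - k)) \<le> m"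
    using \<open>k \<in> {..m}\<close> by simp
qed simp

lemma coeff_mobius_poly:
  assumes "n \<le> m"
  shows "coeff (mobius_poly m a) n = (-1) ^ n * choose_sum m a n"
proof -
  have "coeff (mobius_poly m a) n
      = (\<Sum>k\<le>n. (-1) ^ k * a k * (of_nat ((m - k) choose (n - k)) * (-1) ^ (n - k)))"
    unfolding mobius_poly_def coeff_sum coeff_monom_mult coeff_one_minus_power
    \<comment> \<open>Terms with k > n drop out because they are divisible by x^k.\<close>
    using assms by (intro sum.mono_neutral_cong_right) auto
  also have "\<dots> = (-1) ^ n * choose_sum m a n"
    unfolding choose_sum_def sum_distrib_left
    by (intro sum.cong) (auto simp: neg_one_power_diff ac_simps simp flip: power_mult_distrib)
  finally show ?thesis .
qed

lemma rf_subst_sum_monom: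
  "rf_subst (\<Sum>k\<in>A. monom (c k) (e k)) r = (\<Sum>k\<in>A. to_fract [:c k:] * r ^ e k)"
proof -
  have add: "rf_subst (p + q) r = rf_subst p r + rf_subst q r" for p q
  proof -
    have "map_poly (\<lambda>c. to_fract [:c:]) (p + q)
        = map_poly (\<lambda>c. to_fract [:c:]) p + map_poly (\<lambda>c. to_fract [:c:]) q"
      by (intro poly_eqI) (simp add: coeff_map_poly flip: to_fract_add)
    then show ?thesis by (simp add: rf_subst_def)
  qed
  have "rf_subst (monom (c k) (e k)) r = to_fract [:c k:] * r ^ e k" for k
    by (simp add: rf_subst_def map_poly_monom poly_monom)
  then show ?thesis
    by (induction A rule: infinite_finite_induct) (simp_all add: add, simp_all add: rf_subst_def)
qed

lemma to_fract_power: "to_fract (p ^ n) = to_fract p ^ n"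
  by (induction n) simp_all

lemma to_fract_sum: "to_fract (\<Sum>k\<in>A. f k) = (\<Sum>k\<in>A. to_fract (f k))"
  by (induction A rule: infinite_finite_induct) simp_all

lemma rf_subst_mobius:
  "(1 - rf_var) ^ m * rf_subst (P_star m a) (rf_var / (rf_var - 1)) = to_fract (mobius_poly m a)"
proof -
  let ?x = "rf_var :: 'a poly fract"
  have "[:1, -1 :: 'a:] = 1 - [:0, 1:]"
    by (simp add: one_pCons del: one_poly_eq_simps)
  then have one_minus: "1 - ?x = to_fract [:1, -1:]"
    by (simp only: rf_var_def to_fract_1 to_fract_diff)
  then have nz: "1 - ?x \<noteq> 0" by simp
  have term_eq: "(1 - ?x) ^ m * (to_fract [:c:] * (?x / (?x - 1)) ^ k)
      = to_fract (monom ((-1) ^ k * c) k * [:1, -1:] ^ (m - k))" if "k \<le> m" for k and c :: 'a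
  proof -
    \<comment> \<open>Writing the denominator as 1 - x matches the prefactor; the minus sign left in
      the numerator produces the factor (-1)^k.\<close>
    have "?x / (?x - 1) = - ?x / (1 - ?x)"
      using minus_divide_divide[of ?x "?x - 1"] by (simp only: minus_diff_eq)
    then have "(1 - ?x) ^ m * (to_fract [:c:] * (?x / (?x - 1)) ^ k)
        = to_fract [:c:] * (- ?x) ^ k * ((1 - ?x) ^ m / (1 - ?x) ^ k)"
      by (simp only: power_divide times_divide_eq_left times_divide_eq_right mult_ac)
    also have "(1 - ?x) ^ m / (1 - ?x) ^ k = (1 - ?x) ^ (m - k)"
      using nz that by (simp add: power_diff)
    also have "to_fract [:c:] * (- ?x) ^ k * (1 - ?x) ^ (m - k)
        = to_fract ([:c:] * (- [:0, 1:]) ^ k * [:1, -1:] ^ (m - k))"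
      by (simp only: one_minus) (simp only: rf_var_def to_fract_mult to_fract_power to_fract_uminus)
    also have "[:c:] * (- [:0, 1:]) ^ k = monom ((-1) ^ k * c) k"
    proof -
      have "(- [:0, 1 :: 'a:]) ^ k = smult ((-1) ^ k) (monom 1 k)"
        by (subst power_minus) (cases "even k", auto simp: monom_altdef)
      then show ?thesis by (simp add: smult_monom mult.commute)
    qed
    finally show ?thesis .
  qed
  show ?thesis
    unfolding P_star_def rf_subst_sum_monom sum_distrib_left mobius_poly_def to_fract_sum
    by (intro sum.cong refl term_eq) simp
qed

text \<open>The embedding of polynomials into rational functions is injective, so the identity is
  one between polynomials of degree at most \<open>m\<close>, and coefficients 0, ..., m decide
  it.\<close>

lemma mobius_identity_iff:
  "(1 - rf_var) ^ m * rf_subst (P_star m a) (rf_var / (rf_var - 1))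
      = to_fract [:\<epsilon>:] * rf_subst (P_star m a) rf_var
    \<longleftrightarrow> (\<forall>n\<le>m. (-1) ^ n * choose_sum m a n = \<epsilon> * a n)"
proof -
  have "degree (smult \<epsilon> (P_star m a)) \<le> m"
    by (rule degree_le) (simp add: coeff_P_star zero_ext_def)
  then have "mobius_poly m a = smult \<epsilon> (P_star m a)
      \<longleftrightarrow> (\<forall>n\<le>m. coeff (mobius_poly m a) n = \<epsilon> * zero_ext m a n)"
    using poly_eq_upto_iff[OF degree_mobius_poly, of "smult \<epsilon> (P_star m a)" m a]
    by (simp add: coeff_P_star)
  then show ?thesis
    unfolding rf_subst_mobius rf_subst_rf_var to_fract_mult[symmetric] to_fract_eq_iff
    by (simp add: coeff_mobius_poly zero_ext_def)
qed

section \<open>The reflection x -> 1 - x\<close>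

lemma coeff_reflect_P_poly:
  assumes "n \<le> m"
  shows "coeff (pcompose (P_poly m a) [:1, -1:]) (m - n) = (-1) ^ (m - n) * choose_sum m a n"
proof -
  have monom: "pcompose (monom c d) [:1, -1:] = smult c ([:1, -1:] ^ d)" for c :: 'a and d
    by (induction d) (simp_all add: monom_0 monom_Suc pcompose_pCons)
  have "coeff (pcompose (P_poly m a) [:1, -1:]) (m - n)
      = (\<Sum>k\<le>m. a k * (of_nat ((m - k) choose (m - n)) * (-1) ^ (m - n)))"
    by (simp add: P_poly_def pcompose_sum monom coeff_sum coeff_one_minus_power)
  also have "\<dots> = (\<Sum>k\<le>n. a k * (of_nat ((m - k) choose (n - k)) * (-1) ^ (m - n)))"
  proof (rule sum.mono_neutral_cong_right)
    \<comment> \<open>For n < k \<le> m the lower index m - n exceeds the upper index m - k.\<close>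
    show "\<forall>k\<in>{..m} - {..n}. a k * (of_nat ((m - k) choose (m - n)) * (-1) ^ (m - n)) = 0"
      using assms by auto
  next
    fix k assume "k \<in> {..n}"
    \<comment> \<open>Symmetry of the binomial coefficient applies, as (m - k) - (m - n) = n -
      k.\<close>
    then have "(m - k) choose (m - n) = (m - k) choose (n - k)"
      using assms by (subst binomial_symmetric) auto
    then show "a k * (of_nat ((m - k) choose (m - n)) * (-1) ^ (m - n))
        = a k * (of_nat ((m - k) choose (n - k)) * (-1) ^ (m - n))" by simp
  qed (use assms in auto)
  also have "\<dots> = (-1) ^ (m - n) * choose_sum m a n"
    by (simp add: choose_sum_def sum_distrib_left ac_simps)
  finally show ?thesis .
qed

lemma reflection_identity_iff:
  "pcompose (P_poly m a) [:1, -1:] = smult (\<epsilon> * (-1) ^ m) (P_poly m a)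
    \<longleftrightarrow> (\<forall>n\<le>m. (-1) ^ n * choose_sum m a n = \<epsilon> * a n)"
proof -
  have deg: "degree (P_poly m a) \<le> m"
    unfolding P_poly_def by (intro degree_sum_le order_trans[OF degree_monom_le]) auto
  then have "degree (pcompose (P_poly m a) [:1, -1:]) \<le> m"
    by (simp add: degree_pcompose)
  moreover have "degree (smult (\<epsilon> * (-1) ^ m) (P_poly m a)) \<le> m"
    using deg degree_smult_le order_trans by blast
  ultimately have "pcompose (P_poly m a) [:1, -1:] = smult (\<epsilon> * (-1) ^ m) (P_poly m a)
      \<longleftrightarrow> (\<forall>n\<le>m. (-1) ^ (m - n) * choose_sum m a n = \<epsilon> * (-1) ^ m * a n)"
    by (subst poly_eq_upto_rev_iff) (auto simp: coeff_reflect_P_poly coeff_P_poly)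
  also have "\<dots> \<longleftrightarrow> (\<forall>n\<le>m. (-1) ^ n * choose_sum m a n = \<epsilon> * a n)"
    \<comment> \<open>Splitting (-1)^(m-n) into (-1)^m (-1)^n leaves a common factor (-1)^m, which
      cancels.\<close>
    by (cases "even m") (simp_all add: neg_one_power_diff)
  finally show ?thesis .
qed

section \<open>The binomial sums of (c), (d) and (e)\<close>

lemma gbinomial_sum_eq_choose_sum:
  fixes a :: "nat \<Rightarrow> 'a::real_normed_field"
  assumes "n \<le> m"
  shows "(\<Sum>k\<le>n. ((of_nat n - of_nat m - 1) gchoose k) * (-1) ^ (n - k) * a (n - k))
    = (-1) ^ n * choose_sum m a n"
proof -
  have "(\<Sum>k\<le>n. ((of_nat n - of_nat m - 1) gchoose k) * (-1) ^ (n - k) * a (n - k))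
      = (\<Sum>j\<le>n. ((of_nat n - of_nat m - 1) gchoose (n - j)) * (-1) ^ j * a j)"
    by (rule sum.reindex_bij_witness[of _ "\<lambda>j. n - j" "\<lambda>k. n - k"]) auto
  also have "\<dots> = (\<Sum>j\<le>n. (-1) ^ n * (of_nat ((m - j) choose (n - j)) * a j))"
  proof (intro sum.cong refl)
    fix j assume "j \<in> {..n}"
    then have j: "j \<le> n" by simp
    \<comment> \<open>This is the upper index k - x - 1 that negation attaches to x = n - m - 1 and
      k = n - j. The resulting sign (-1)^(n-j) combines with (-1)^j to (-1)^n, independent of
      j.\<close>
    have "of_nat (n - j) - (of_nat n - of_nat m - 1) - 1 = (of_nat (m - j) :: 'a)"
      using j assms by (simp add: of_nat_diff)
    then have "((of_nat n - of_nat m - 1) gchoose (n - j))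
        = (-1) ^ (n - j) * (of_nat ((m - j) choose (n - j)) :: 'a)"
      by (subst gbinomial_negated_upper) (simp add: binomial_gbinomial)
    then show "((of_nat n - of_nat m - 1) gchoose (n - j)) * (-1) ^ j * a j
        = (-1) ^ n * (of_nat ((m - j) choose (n - j)) * a j)"
      using j by (simp add: neg_one_power_diff minus_one_power_iff)
  qed
  also have "\<dots> = (-1) ^ n * choose_sum m a n"
    by (simp add: choose_sum_def sum_distrib_left)
  finally show ?thesis .
qed

text \<open>For \<open>n > m\<close> the upper index \<open>n - m - 1\<close> is a natural number less than every \<open>k\<close> with
  \<open>n - k \<le> m\<close>.\<close>

lemma gbinomial_sum_zero_ext_eq_0:
  fixes a :: "nat \<Rightarrow> 'a::real_normed_field"
  assumes "m < n"
  shows "(\<Sum>k\<le>n. ((of_nat n - of_nat m - 1) gchoose k) * (-1) ^ (n - k) * zero_ext m a (n - k)) = 0"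
proof (intro sum.neutral ballI)
  fix k
  have "((of_nat n - of_nat m - 1) gchoose k) = (of_nat ((n - m - 1) choose k) :: 'a)"
    using assms by (simp add: binomial_gbinomial of_nat_diff algebra_simps)
  moreover have "(n - m - 1) choose k = 0 \<or> zero_ext m a (n - k) = 0"
    using assms by (auto simp: zero_ext_def binomial_eq_0_iff)
  ultimately show
    "((of_nat n - of_nat m - 1) gchoose k) * (-1) ^ (n - k) * zero_ext m a (n - k) = 0"
    by auto
qed

lemma choose_ratio_sum_eq_choose_sum:
  fixes a :: "nat \<Rightarrow> 'a::real_normed_field"
  assumes "n \<le> m"
  shows "(\<Sum>k\<le>n. of_nat (n choose k) * (a k / of_nat (m choose k)))
    = choose_sum m a n / of_nat (m choose n)"
  unfolding choose_sum_def sum_divide_distrib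
proof (intro sum.cong refl)
  fix k assume "k \<in> {..n}"
  then have "(m choose n) * (n choose k) = (m choose k) * ((m - k) choose (n - k))"
    using assms by (intro choose_mult) auto
  then have "of_nat (m choose n) * of_nat (n choose k)
      = (of_nat (m choose k) * of_nat ((m - k) choose (n - k)) :: 'a)"
    by (metis of_nat_mult)
  \<comment> \<open>Both binomials are positive because k \<le> n \<le> m, and the field has
    characteristic 0, so the denominators can be cleared.\<close>
  moreover have "of_nat (m choose n) \<noteq> (0 :: 'a)" "of_nat (m choose k) \<noteq> (0 :: 'a)"
    using \<open>k \<in> {..n}\<close> assms by auto
  ultimately show "of_nat (n choose k) * (a k / of_nat (m choose k))
      = of_nat ((m - k) choose (n - k)) * a k / (of_nat (m choose n) :: 'a)"
    by (simp add: field_simps)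
qed

theorem theorem2p5:
  fixes m :: nat and a :: "nat \<Rightarrow> 'a::real_normed_field" and \<epsilon> :: 'a
  assumes "m > 0" and "\<epsilon> \<in> {1, -1}"
  shows
    "let
       A = ((1 - rf_var) ^ m * rf_subst (P_star m a) (rf_var / (rf_var - 1))
              = to_fract [:\<epsilon>:] * rf_subst (P_star m a) rf_var);
       B = (pcompose (P_poly m a) [:1, -1:] = smult (\<epsilon> * (-1) ^ m) (P_poly m a));
       C = (\<forall>n\<le>m. (\<Sum>k\<le>n. ((of_nat n - of_nat m - 1) gchoose k) * (-1) ^ (n - k) * a (n - k))
              = \<epsilon> * a n);
       D = (\<forall>n. (\<Sum>k\<le>n. ((of_nat n - of_nat m - 1) gchoose k) * (-1) ^ (n - k)
                       * zero_ext m a (n - k))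
              = \<epsilon> * zero_ext m a n);
       E = (\<forall>n\<le>m. (\<Sum>k\<le>n. of_nat (n choose k) * (a k / of_nat (m choose k)))
              = \<epsilon> * (-1) ^ n * (a n / of_nat (m choose n)))
     in (A \<longleftrightarrow> B) \<and> (B \<longleftrightarrow> C) \<and> (C \<longleftrightarrow> D) \<and> (D \<longleftrightarrow> E)"
proof -
  \<comment> \<open>The common condition carries (-1)^n on the left, the form in which (a), (b) and
    (c) yield it.\<close>
  let ?S = "\<forall>n\<le>m. (-1) ^ n * choose_sum m a n = \<epsilon> * a n"
  let ?g = "\<lambda>b n. \<Sum>k\<le>n. ((of_nat n - of_nat m - 1) gchoose k) * (-1) ^ (n - k) * b (n - k) :: 'a"
  have C: "(\<forall>n\<le>m. ?g a n = \<epsilon> * a n) \<longleftrightarrow> ?S"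
    by (simp add: gbinomial_sum_eq_choose_sum)
  have "?g (zero_ext m a) n = ?g a n" if "n \<le> m" for n
    using that by (intro sum.cong) (auto simp: zero_ext_def)
  \<comment> \<open>For n > m both sides are 0, so (d) imposes only the conditions of (c).\<close>
  then have "?g (zero_ext m a) n = \<epsilon> * zero_ext m a n \<longleftrightarrow> (n \<le> m \<longrightarrow> ?g a n = \<epsilon> * a n)" for n
    using gbinomial_sum_zero_ext_eq_0[of m n a]
    by (cases "n \<le> m") (simp_all add: zero_ext_def)
  then have D: "(\<forall>n. ?g (zero_ext m a) n = \<epsilon> * zero_ext m a n) \<longleftrightarrow> ?S"
    using C by simp
  \<comment> \<open>Cancel the nonzero binomial, then move (-1)^n, its own inverse, across the
    equation; for odd n this is a change of sign on both sides.\<close>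
  have "choose_sum m a n / of_nat (m choose n) = \<epsilon> * (-1) ^ n * (a n / of_nat (m choose n))
      \<longleftrightarrow> (-1) ^ n * choose_sum m a n = \<epsilon> * a n" if "n \<le> m" for n
    using that minus_equation_iff[of "choose_sum m a n" "\<epsilon> * a n"]
    by (cases "even n") (auto simp: field_simps)
  then have E: "(\<forall>n\<le>m. (\<Sum>k\<le>n. of_nat (n choose k) * (a k / of_nat (m choose k)))
      = \<epsilon> * (-1) ^ n * (a n / of_nat (m choose n))) \<longleftrightarrow> ?S"
    by (simp add: choose_ratio_sum_eq_choose_sum del: times_divide_eq_right)
  show ?thesis
    unfolding Let_def mobius_identity_iff reflection_identity_iff C D E by simp
qed

end
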